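(* For each integer $d\ge 0$, let $g(d)$ be the least integer $k$ such that for every finite graph $G$ of maximum degree $d$ and every integer initial labelling of $G$ in which each vertex has label at least $k$, all vertex labels in the diffusion game on $G$ are non-negative at all times $t\ge 0$; put $g(d)=\infty$ if no such $k$ exists. Then: (i) if $d\le 1$, then $g(d)=0$; (ii) if $d=2$, then $g(d)=1$; (iii) if $d=3$, then $g(d)\ge 3$; (iv) if $d\ge 4$, then $g(d)=\infty$.
   Context: Graphs are simple and undirected; $\Gamma(v)$ denotes the set of neighbours of $v$. Diffusion game on a graph $G$: each vertex $v$ has an initial integer label $w_v(0)\in\mathbb{Z}$ (number of chips), and all labels are updated simultaneously at discrete times $t=0,1,2,\dots$ by $$w_v(t+1)=w_v(t)+|\{u\in\Gamma(v): w_u(t)>w_v(t)\}|-|\{u\in\Gamma(v): w_u(t)<w_v(t)\}|.$$ Labels are allowed to become negative. *)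

theory Defs
  imports "Graph_Theory.Pair_Digraph" "HOL-Library.Extended"
begin

text \<open>
  A finite simple undirected graph is a \<^locale>\<open>pair_graph\<close>: a finite vertex set with a symmetric,
  irreflexive adjacency relation on it.
\<close>

definition neighbours :: "'a pair_pre_digraph \<Rightarrow> 'a \<Rightarrow> 'a set" where
  "neighbours G v = {u. (v, u) \<in> parcs G}"

text \<open>The \<open>insert 0\<close> only fixes the value for the graph without vertices.\<close>

definition max_degree :: "'a pair_pre_digraph \<Rightarrow> nat" where
  "max_degree G = Max (insert 0 ((\<lambda>v. card (neighbours G v)) ` pverts G))"

text \<open>
  Labels are total functions on the vertex type; since edges join vertices only, values outside
  \<open>pverts G\<close> have no influence on the labels of vertices.
\<close>

definition diffusion_step :: "'a pair_pre_digraph \<Rightarrow> ('a \<Rightarrow> int) \<Rightarrow> 'a \<Rightarrow> int" where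
  "diffusion_step G w v =
     w v + int (card {u \<in> neighbours G v. w u > w v}) - int (card {u \<in> neighbours G v. w u < w v})"

primrec diffusion :: "'a pair_pre_digraph \<Rightarrow> ('a \<Rightarrow> int) \<Rightarrow> nat \<Rightarrow> 'a \<Rightarrow> int" where
  "diffusion G w 0 = w"
| "diffusion G w (Suc t) = diffusion_step G (diffusion G w t)"

text \<open>
  A definition cannot quantify over types, so the graphs range over those with vertices in
  \<^typ>\<open>nat\<close>, which cover all finite graphs up to isomorphism; lemma \<open>safe_level_any_type\<close> below
  transfers the property to an arbitrary vertex type.
\<close>

definition safe_level :: "nat \<Rightarrow> int \<Rightarrow> bool" where
  "safe_level d k \<longleftrightarrow>
     (\<forall>(G :: nat pair_pre_digraph) w.
        pair_graph G \<longrightarrow> max_degree G = d \<longrightarrow> (\<forall>v \<in> pverts G. w v \<ge> k) \<longrightarrow>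
        (\<forall>t. \<forall>v \<in> pverts G. diffusion G w t v \<ge> 0))"

definition g :: "nat \<Rightarrow> int extended" where
  "g d = (if \<exists>k. safe_level d k then Fin (LEAST k. safe_level d k) else Pinf)"

lemma safe_level_any_type:
  fixes G :: "'a pair_pre_digraph" and w :: "'a \<Rightarrow> int"
  assumes safe: "safe_level (max_degree G) k" and G: "pair_graph G"
    and w: "\<And>v. v \<in> pverts G \<Longrightarrow> w v \<ge> k" and v: "v \<in> pverts G"
  shows "diffusion G w t v \<ge> 0"
proof -
  interpret pair_graph G by (rule G)
  obtain f :: "'a \<Rightarrow> nat" where f: "inj_on f (pverts G)"
    using finite_imp_inj_to_nat_seg pair_finite_verts by metis
  define H where "H = \<lparr>pverts = f ` pverts G, parcs = map_prod f f ` parcs G\<rparr>"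
  define w' where "w' = w \<circ> inv_into (pverts G) f"
  have H_graph: "pair_graph H"
  proof
    show "fst e \<in> pverts H" "snd e \<in> pverts H" if "e \<in> parcs H" for e
      using that by (auto simp: H_def in_arcsD1 in_arcsD2)
    show "finite (pverts H)" "finite (parcs H)"
      by (simp_all add: H_def pair_finite_verts pair_finite_arcs)
    show "fst e \<noteq> snd e" if e: "e \<in> parcs H" for e
    proof -
      from e obtain x y where "e = (f x, f y)" "(x, y) \<in> parcs G"
        by (auto simp: H_def)
      then show ?thesis
        using f pair_no_loops[of "(x, y)"] in_arcsD1 in_arcsD2 by (auto dest: inj_onD)
    qed
    show "symmetric H"
      using pair_sym_arcs by (force simp: H_def symmetric_def sym_def)
  qed
  have nsub: "neighbours G x \<subseteq> pverts G" for x
    using in_arcsD2 by (auto simp: neighbours_def)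
  have nbr: "neighbours H (f x) = f ` neighbours G x" if "x \<in> pverts G" for x
  proof -
    have "(x, b) \<in> parcs G" if "(a, b) \<in> parcs G" "f x = f a" for a b
      using that \<open>x \<in> pverts G\<close> in_arcsD1[of a b] f by (auto dest: inj_onD)
    then show ?thesis
      unfolding neighbours_def H_def by force
  qed
  have card_f: "card (f ` A) = card A" if "A \<subseteq> neighbours G x" for A x
    using that nsub f by (meson card_image inj_on_subset)
  have "card (neighbours H (f x)) = card (neighbours G x)" if "x \<in> pverts G" for x
    using that by (simp add: nbr card_f[OF subset_refl])
  moreover have "pverts H = f ` pverts G"
    by (simp add: H_def)
  ultimately have "(\<lambda>v. card (neighbours H v)) ` pverts H = (\<lambda>v. card (neighbours G v)) ` pverts G"
    by (simp add: image_image)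
  then have deg: "max_degree H = max_degree G"
    by (simp add: max_degree_def)
  have diff: "diffusion H w' t (f x) = diffusion G w t x" if "x \<in> pverts G" for t x
    using that
  proof (induction t arbitrary: x)
    case 0
    then show ?case by (simp add: w'_def f)
  next
    case (Suc t)
    have "diffusion H w' t (f u) = diffusion G w t u" if "u \<in> neighbours G x" for u
      using Suc.IH nsub that by blast
    then have "{u \<in> neighbours H (f x). P (diffusion H w' t u)}
            = f ` {u \<in> neighbours G x. P (diffusion G w t u)}" for P
      using Suc.prems by (auto simp: nbr)
    then have "card {u \<in> neighbours H (f x). P (diffusion H w' t u)}
                 = card {u \<in> neighbours G x. P (diffusion G w t u)}" for P
      using card_f[of "{u \<in> neighbours G x. P (diffusion G w t u)}" x] by auto
    from this[of "\<lambda>y. y > diffusion G w t x"] this[of "\<lambda>y. y < diffusion G w t x"]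
    show ?case
      using Suc by (simp add: diffusion_step_def)
  qed
  have "w' u \<ge> k" if "u \<in> pverts H" for u
    using that w f by (auto simp: H_def w'_def)
  then have "diffusion H w' t (f v) \<ge> 0"
    using safe H_graph deg v unfolding safe_level_def by (simp add: H_def)
  then show ?thesis
    using diff v by simp
qed

end

theory Submission
  imports Defs
begin

text \<open>
  For maximum degree 2, the only way to reach a negative label is a 1 between two 0s. Call a
  non-backtracking walk labelled \<open>0, 1, \<dots>, 1, 0\<close> a zero path. Tracing a zero path with \<open>j\<close> ones
  one step back in time yields a zero path with \<open>j + 2\<close> ones (or an even simpler one), and there are
  none at time 0 if all labels are positive.

  For maximum degree at least 4, take a tree in which every inner vertex other than the root has
  three children, labelled by the distance from the leaf level. Away from the root every inner
  vertex loses 3 chips and gains 1, so that at time \<open>t\<close> the vertices at height \<open>t\<close> have lost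
  \<open>2 t\<close> chips, and \<open>t\<close> can be made arbitrarily large.
\<close>

section \<open>Neighbourhoods and safe levels\<close>

lemma (in pair_graph) finite_neighbours: "finite (neighbours G v)"
proof (rule finite_subset)
  show "neighbours G v \<subseteq> pverts G"
    by (auto simp: neighbours_def in_arcsD2)
qed simp

lemma (in pair_graph) neighbours_sym: "u \<in> neighbours G v \<longleftrightarrow> v \<in> neighbours G u"
  using pair_sym_arcs by (auto simp: neighbours_def symmetric_def dest: symD)

lemma (in pair_graph) neighbour_in_verts: "u \<in> neighbours G v \<Longrightarrow> u \<in> pverts G"
  by (auto simp: neighbours_def in_arcsD2)

text \<open>A single sum of signs can be split over individual neighbours or evaluated on
  lists.\<close>

lemma diffusion_step_sum:
  assumes "finite (neighbours G v)"
  shows "diffusion_step G w v = w v + (\<Sum>u\<in>neighbours G v. sgn (w u - w v))"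
proof -
  have "(\<Sum>u\<in>neighbours G v. sgn (w u - w v))
      = (\<Sum>u\<in>neighbours G v. of_bool (w u > w v) - of_bool (w u < w v))"
    by (rule sum.cong) (auto simp: sgn_if)
  also have "\<dots> = int (card {u \<in> neighbours G v. w u > w v})
      - int (card {u \<in> neighbours G v. w u < w v})"
    using assms by (simp add: sum_subtractf sum_of_bool_eq Int_def)
  finally show ?thesis
    by (simp add: diffusion_step_def)
qed

lemma max_degree_eqI:
  assumes "finite (pverts G)" "v \<in> pverts G" "card (neighbours G v) = d"
    and "\<And>u. u \<in> pverts G \<Longrightarrow> card (neighbours G u) \<le> d"
  shows "max_degree G = d"
  unfolding max_degree_def using assms by (intro Max_eqI) auto

lemma (in pair_graph) card_neighbours_le_max_degree:
  "card (neighbours G v) \<le> max_degree G"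
proof (cases "v \<in> pverts G")
  case True
  then show ?thesis
    unfolding max_degree_def by (intro Max_ge) auto
next
  case False
  then have "neighbours G v = {}"
    by (auto simp: neighbours_def in_arcsD1)
  then show ?thesis by simp
qed

lemma safe_level_mono: "safe_level d k \<Longrightarrow> k \<le> k' \<Longrightarrow> safe_level d k'"
  unfolding safe_level_def using order_trans[of k k'] by blast

lemma g_eqI:
  assumes "safe_level d k" "\<not> safe_level d (k - 1)"
  shows "g d = Fin k"
proof -
  have "(LEAST k. safe_level d k) = k"
    using assms safe_level_mono[of d _ "k - 1"] by (intro Least_equality) force+
  then show ?thesis
    using assms by (auto simp: g_def)
qed

text \<open>On the integers \<open>LEAST\<close> is meaningful only if the safe levels are bounded
  below. By monotonicity all of them are at least \<open>k\<close>, so the least one is found among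
  the offsets \<open>k + int n\<close>.\<close>

lemma g_geI:
  assumes "\<not> safe_level d (k - 1)"
  shows "g d \<ge> Fin k"
proof (cases "\<exists>m. safe_level d m")
  case True
  have lower: "m \<ge> k" if "safe_level d m" for m
    using that assms safe_level_mono[of d m "k - 1"] by force
  define n where "n = (LEAST n. safe_level d (k + int n))"
  have ex: "\<exists>n. safe_level d (k + int n)"
    using True lower by (metis zle_iff_zadd)
  have "safe_level d (k + int n)"
    using ex unfolding n_def by (rule LeastI_ex)
  moreover have "\<not> safe_level d (k + int n - 1)"
  proof
    assume safe: "safe_level d (k + int n - 1)"
    then obtain i where i: "k + int n - 1 = k + int i"
      using lower zle_iff_zadd by blast
    then have "i < n" by simp
    then have "\<not> safe_level d (k + int i)"
      using not_less_Least[of i "\<lambda>n. safe_level d (k + int n)"] unfolding n_def by force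
    then show False
      using safe i by simp
  qed
  ultimately have "g d = Fin (k + int n)"
    by (rule g_eqI)
  then show ?thesis by simp
qed (simp add: g_def)

section \<open>Maximum degree at most 1\<close>

text \<open>A vertex with at most one neighbour loses at most one chip, and none at label 0, where
  no neighbour is lower.\<close>

lemma safe_level_0:
  assumes "d \<le> 1"
  shows "safe_level d 0"
  unfolding safe_level_def
proof (intro allI impI)
  fix G :: "nat pair_pre_digraph" and w :: "nat \<Rightarrow> int" and t
  assume "pair_graph G" and d: "max_degree G = d" and w: "\<forall>v\<in>pverts G. 0 \<le> w v"
  then interpret pair_graph G by simp
  show "\<forall>v\<in>pverts G. 0 \<le> diffusion G w t v"
  proof (induction t)
    case 0
    then show ?case using w by simp
  next
    case (Suc t)
    show ?case
    proof
      fix v assume v: "v \<in> pverts G"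
      let ?w = "diffusion G w t" and ?L = "{u \<in> neighbours G v. diffusion G w t u < diffusion G w t v}"
      have "card ?L \<le> card (neighbours G v)"
        by (intro card_mono finite_neighbours) auto
      then have L: "card ?L \<le> 1"
        using card_neighbours_le_max_degree[of v] assms d by linarith
      have "card ?L = 0" if "?w v = 0"
        using that Suc.IH neighbour_in_verts by (fastforce simp: card_eq_0_iff)
      then have "int (card ?L) \<le> ?w v"
        using L Suc.IH v by (cases "?w v = 0") force+
      then show "0 \<le> diffusion G w (Suc t) v"
        by (simp add: diffusion_step_def)
    qed
  qed
qed

section \<open>Maximum degree 2\<close>

text \<open>The arc \<open>(u, v)\<close> starts a non-backtracking walk whose labels after \<open>u\<close> are \<open>1, \<dots>, 1, 0\<close>.\<close>

inductive ones_to_zero :: "'a pair_pre_digraph \<Rightarrow> ('a \<Rightarrow> int) \<Rightarrow> 'a \<Rightarrow> 'a \<Rightarrow> bool"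
  for G w where
  zero: "v \<in> neighbours G u \<Longrightarrow> w v = 0 \<Longrightarrow> ones_to_zero G w u v"
| one: "v \<in> neighbours G u \<Longrightarrow> w v = 1 \<Longrightarrow> ones_to_zero G w v v' \<Longrightarrow> v' \<noteq> u \<Longrightarrow> ones_to_zero G w u v"

definition zero_path :: "'a pair_pre_digraph \<Rightarrow> ('a \<Rightarrow> int) \<Rightarrow> bool" where
  "zero_path G w \<longleftrightarrow> (\<exists>u v. w u = 0 \<and> ones_to_zero G w u v)"

lemma ones_to_zero_neighbour: "ones_to_zero G w u v \<Longrightarrow> v \<in> neighbours G u"
  by (erule ones_to_zero.cases) auto

lemma ones_to_zero_single:
  assumes "v \<in> neighbours G u" "w v = 1" "y \<in> neighbours G v" "w y = 0" "y \<noteq> u"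
  shows "ones_to_zero G w u v"
  using assms(1,2) ones_to_zero.zero[of y G v w, OF assms(3,4)] assms(5)
  by (rule ones_to_zero.one)

text \<open>The invariant for the induction over time: the assumptions on \<open>w\<close> are shown
  to pass to \<open>diffusion_step G w\<close>.\<close>

locale degree_two = pair_graph G for G :: "'a pair_pre_digraph" +
  fixes w :: "'a \<Rightarrow> int"
  assumes degree: "card (neighbours G v) \<le> 2"
    and nonneg: "v \<in> pverts G \<Longrightarrow> w v \<ge> 0"
    and no_zero_path: "\<not> zero_path G w"
begin

section \<open>One step at a vertex with at most two neighbours\<close>

lemma step_cases:
  assumes "u \<in> neighbours G v"
  obtains (single) "neighbours G v = {u}" "diffusion_step G w v = w v + sgn (w u - w v)"
  | (pair) y where "y \<in> neighbours G v" "y \<noteq> u" "neighbours G v = {u, y}"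
      "diffusion_step G w v = w v + sgn (w u - w v) + sgn (w y - w v)"
proof -
  have "card (neighbours G v - {u}) \<le> 1"
    using degree[of v] assms finite_neighbours by (simp add: card_Diff_singleton)
  moreover have "finite (neighbours G v - {u})"
    using finite_neighbours by simp
  ultimately consider "neighbours G v - {u} = {}" | y where "neighbours G v - {u} = {y}"
    by (metis card_0_eq card_1_singletonE le_eq_less_or_eq less_one)
  then show thesis
  proof cases
    case 1
    then have "neighbours G v = {u}" using assms by auto
    then show thesis
      by (intro single) (simp_all add: diffusion_step_sum)
  next
    case (2 y)
    then have "y \<noteq> u" "neighbours G v = {u, y}" using assms by auto
    then show thesis
      by (intro pair[of y]) (auto simp: diffusion_step_sum)
  qed
qed

lemma neighbour_pos:
  assumes "w v = 0" "u \<in> neighbours G v"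
  shows "w u > 0"
proof -
  have "w u \<noteq> 0"
    using assms no_zero_path ones_to_zero.zero unfolding zero_path_def by metis
  then show ?thesis
    using nonneg[OF neighbour_in_verts] assms by force
qed

lemma step_nonneg:
  assumes "v \<in> pverts G"
  shows "diffusion_step G w v \<ge> 0"
proof (rule ccontr)
  assume neg: "\<not> diffusion_step G w v \<ge> 0"
  have v: "w v \<ge> 0" using assms nonneg by simp
  have pos: "w u \<ge> 0" if "u \<in> neighbours G v" for u
    using that nonneg neighbour_in_verts by blast
  show False
  proof (cases "neighbours G v = {}")
    case True
    then show False using neg v by (simp add: diffusion_step_sum)
  next
    case False
    then obtain u where u: "u \<in> neighbours G v" by blast
    then show False
    proof (cases rule: step_cases)
      case single
      then show False using neg v pos[OF u] by (auto simp: sgn_if split: if_splits)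
    next
      case (pair y)
      \<comment> \<open>Losing two chips from label 1 is the only way below 0, and this is a zero
        path with a single 1.\<close>
      have "w v = 1 \<and> w u = 0 \<and> w y = 0"
        using pair neg v pos[OF u] pos[of y] by (auto simp: sgn_if split: if_splits)
      moreover from this have "ones_to_zero G w u v"
        using ones_to_zero_single[of v G u w y] u pair neighbours_sym by blast
      ultimately show False
        using no_zero_path by (auto simp: zero_path_def)
    qed
  qed
qed

text \<open>An old label 0 is impossible, as all neighbours would be positive and \<open>v\<close>
  would rise. What remains is a net loss of 1 from label 1 or of 2 from label 2.\<close>

lemma step_zero:
  assumes step: "diffusion_step G w v = 0" and u: "u \<in> neighbours G v"
  shows "w v = 1 \<and> w u = 0 \<or> w v = 1 \<and> w u = 1 \<and> (\<exists>y\<in>neighbours G v. y \<noteq> u \<and> w y = 0)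
    \<or> w v = 2 \<and> w u \<le> 1"
proof -
  have v: "w v \<ge> 0"
    using u nonneg neighbour_in_verts neighbours_sym by blast
  have pos: "w x \<ge> 0" "w v = 0 \<Longrightarrow> w x > 0" if "x \<in> neighbours G v" for x
    using that nonneg neighbour_in_verts neighbour_pos by blast+
  from u show ?thesis
  proof (cases rule: step_cases)
    case single
    then show ?thesis
      using step v pos[OF u] by (auto simp: sgn_if split: if_splits)
  next
    case (pair y)
    then show ?thesis
      using step v pos[OF u] pos[of y] by (auto simp: sgn_if split: if_splits)
  qed
qed

text \<open>Both neighbours of a 0 are positive, so the label jumps to 2.\<close>

lemma step_of_zero:
  assumes "w v = 0" "u \<in> neighbours G v" "y \<in> neighbours G v" "u \<noteq> y"
  shows "diffusion_step G w v \<noteq> 1"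
  using assms(2)
proof (cases rule: step_cases)
  case single
  then show ?thesis using assms by auto
next
  case (pair z)
  then show ?thesis using neighbour_pos[OF assms(1)] assms(1,2) by simp
qed

lemma step_one_one:
  assumes "w v = 1" "diffusion_step G w v = 1"
    and "u \<in> neighbours G v" "y \<in> neighbours G v" "u \<noteq> y"
  shows "sgn (w y - 1) = - sgn (w u - 1)"
  using assms(3)
proof (cases rule: step_cases)
  case single
  then show ?thesis using assms by auto
next
  case (pair z)
  then show ?thesis using assms by auto
qed

text \<open>Two consecutive old ones propagate along the walk by \<open>step_one_one\<close>. At its
  end, a 1 that drops to 0 beside a 1 has an old 0 on its other side, so the old walk is one vertex
  longer.\<close>

lemma ones_to_zero_back:
  assumes "ones_to_zero G (diffusion_step G w) u v" "w u = 1" "w v = 1"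
  shows "ones_to_zero G w u v"
  using assms
proof (induction rule: ones_to_zero.induct)
  case (zero v u)
  then obtain y where "y \<in> neighbours G v" "y \<noteq> u" "w y = 0"
    using step_zero[of v u] neighbours_sym by auto
  then show ?case
    using zero by (intro ones_to_zero_single)
next
  case (one v u v')
  have "v' \<in> neighbours G v"
    using one.hyps(3) by (rule ones_to_zero_neighbour)
  then have "w v' = 1"
    using step_one_one[of v u v'] one neighbours_sym by (auto simp: sgn_0_0)
  then show ?case
    using one by (blast intro: ones_to_zero.one)
qed

lemma step_no_zero_path: "\<not> zero_path G (diffusion_step G w)"
proof
  let ?w = "diffusion_step G w"
  assume "zero_path G ?w"
  then obtain u v where u0: "?w u = 0" and uv: "ones_to_zero G ?w u v"
    by (auto simp: zero_path_def)
  from uv have v: "v \<in> neighbours G u"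
    by (rule ones_to_zero_neighbour)
  then have u: "u \<in> neighbours G v"
    using neighbours_sym by blast
  from uv have ones: "w u = 1 \<and> w v = 1"
  proof cases
    case zero
    then show ?thesis
      using step_zero[OF u0 v] step_zero[OF _ u] by auto
  next
    case (one v')
    have v': "v' \<in> neighbours G v"
      using one(3) by (rule ones_to_zero_neighbour)
    have "w v' \<noteq> 0"
      using one(3)
    proof cases
      case zero
      then show ?thesis
        using step_zero[of v' v] v' neighbours_sym by auto
    next
      case (one v'')
      then show ?thesis
        using step_of_zero[of v' v v''] v' neighbours_sym ones_to_zero_neighbour[of G ?w v' v'']
        by auto
    qed
    moreover have "w v \<noteq> 0"
      using step_of_zero[OF _ u v'] one by auto
    moreover have "w v' \<ge> 0" "w v \<ge> 0"
      using v v' nonneg neighbour_in_verts by blast+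
    \<comment> \<open>The alternative \<open>w u = 2\<close>, \<open>w v = 1\<close> would force
      \<open>w v' = 0\<close>, since \<open>v\<close> stays at 1.\<close>
    ultimately show ?thesis
      using step_zero[OF u0 v] step_one_one[OF _ _ u v'] one by (auto simp: sgn_if split: if_splits)
  qed
  \<comment> \<open>The old path is extended at its start as well, by a 0 before
    \<open>u\<close>.\<close>
  then obtain y where y: "y \<in> neighbours G u" "y \<noteq> v" "w y = 0"
    using step_zero[OF u0 v] by auto
  have "ones_to_zero G w y u"
    using ones_to_zero_back[OF uv] ones y neighbours_sym by (metis ones_to_zero.one)
  then show False
    using no_zero_path y by (auto simp: zero_path_def)
qed

end

lemma safe_level_2: "safe_level 2 1"
  unfolding safe_level_def
proof (intro allI impI)
  fix G :: "nat pair_pre_digraph" and w :: "nat \<Rightarrow> int" and t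
  assume "pair_graph G" and d: "max_degree G = 2" and w: "\<forall>v\<in>pverts G. 1 \<le> w v"
  then interpret pair_graph G by simp
  have "degree_two G (diffusion G w t)"
  proof (induction t)
    case 0
    have "\<not> zero_path G w"
    proof
      assume "zero_path G w"
      then obtain u v where "w u = 0" "v \<in> neighbours G u"
        using ones_to_zero_neighbour unfolding zero_path_def by metis
      \<comment> \<open>Labels outside the graph are unconstrained, but having a neighbour places
        \<open>u\<close> in the graph.\<close>
      then show False
        using w neighbours_sym neighbour_in_verts by fastforce
    qed
    moreover have "0 \<le> w v" if "v \<in> pverts G" for v
      using w that by force
    ultimately show ?case
      using card_neighbours_le_max_degree d by unfold_locales auto
  next
    case (Suc t)
    interpret degree_two G "diffusion G w t" by (rule Suc.IH)
    show ?case
      using degree step_nonneg step_no_zero_path by unfold_locales auto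
  qed
  then interpret degree_two G "diffusion G w t" .
  show "\<forall>v\<in>pverts G. 0 \<le> diffusion G w t v"
    using nonneg by blast
qed

section \<open>Explicit small examples\<close>

text \<open>Adjacency lists make concrete graphs and their steps executable, so counterexamples can
  be checked by evaluation.\<close>

definition list_graph :: "nat list list \<Rightarrow> nat pair_pre_digraph" where
  "list_graph adj = \<lparr>pverts = {..<length adj}, parcs = {(v, u). v < length adj \<and> u \<in> set (adj ! v)}\<rparr>"

definition adjacency_lists :: "nat list list \<Rightarrow> bool" where
  "adjacency_lists adj \<longleftrightarrow> (\<forall>v\<in>set [0..<length adj]. distinct (adj ! v) \<and>
     (\<forall>u\<in>set (adj ! v). u < length adj \<and> u \<noteq> v \<and> v \<in> set (adj ! u)))"

definition list_step :: "nat list list \<Rightarrow> int list \<Rightarrow> int list" where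
  "list_step adj xs = map (\<lambda>v. xs ! v + (\<Sum>u\<leftarrow>adj ! v. sgn (xs ! u - xs ! v))) [0..<length adj]"

lemma adjacency_listsD:
  assumes "adjacency_lists adj" "v < length adj"
  shows "distinct (adj ! v)"
    and "u \<in> set (adj ! v) \<Longrightarrow> u < length adj \<and> u \<noteq> v \<and> v \<in> set (adj ! u)"
  using assms unfolding adjacency_lists_def atLeast_upt[symmetric] by blast+

lemma pair_graph_list_graph:
  assumes "adjacency_lists adj"
  shows "pair_graph (list_graph adj)"
proof
  let ?G = "list_graph adj"
  have arc: "v < length adj \<and> u < length adj \<and> u \<noteq> v \<and> (u, v) \<in> parcs ?G"
    if "(v, u) \<in> parcs ?G" for v u
    using that adjacency_listsD(2)[OF assms, of v u] by (simp add: list_graph_def)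
  show verts: "fst e \<in> pverts ?G" "snd e \<in> pverts ?G" if "e \<in> parcs ?G" for e
    using that arc[of "fst e" "snd e"] by (simp_all add: list_graph_def)
  show "finite (pverts ?G)"
    by (simp add: list_graph_def)
  moreover have "parcs ?G \<subseteq> pverts ?G \<times> pverts ?G"
    using verts by force
  ultimately show "finite (parcs ?G)"
    by (meson finite_SigmaI finite_subset)
  show "fst e \<noteq> snd e" if "e \<in> parcs ?G" for e
    using that arc[of "fst e" "snd e"] by simp
  show "symmetric ?G"
    using arc by (auto simp: symmetric_def intro: symI)
qed

lemma pverts_list_graph: "pverts (list_graph adj) = {..<length adj}"
  by (simp add: list_graph_def)

lemma neighbours_list_graph:
  "v < length adj \<Longrightarrow> neighbours (list_graph adj) v = set (adj ! v)"
  by (simp add: list_graph_def neighbours_def)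

lemma list_step_nth:
  "v < length adj \<Longrightarrow> list_step adj xs ! v = xs ! v + (\<Sum>u\<leftarrow>adj ! v. sgn (xs ! u - xs ! v))"
  by (simp add: list_step_def)

lemma diffusion_list_graph:
  assumes adj: "adjacency_lists adj" and "length xs = length adj" and "v < length adj"
  shows "diffusion (list_graph adj) ((!) xs) t v = (list_step adj ^^ t) xs ! v"
  using \<open>v < length adj\<close>
proof (induction t arbitrary: v)
  case (Suc t)
  let ?ys = "(list_step adj ^^ t) xs" and ?w = "diffusion (list_graph adj) ((!) xs) t"
  note D = adjacency_listsD[OF adj Suc.prems]
  have "sum_list (map (\<lambda>u. sgn (?ys ! u - ?ys ! v)) (adj ! v))
      = (\<Sum>u\<in>set (adj ! v). sgn (?ys ! u - ?ys ! v))"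
    using D(1) by (rule sum_list_distinct_conv_sum_set)
  also have "\<dots> = (\<Sum>u\<in>set (adj ! v). sgn (?w u - ?w v))"
    using Suc.IH Suc.prems D(2) by (intro sum.cong) simp_all
  finally show ?case
    using Suc by (simp add: diffusion_step_sum neighbours_list_graph list_step_nth)
qed simp

lemma not_safe_level_list_graph:
  assumes adj: "adjacency_lists adj" and len: "length xs = length adj" "adj \<noteq> []"
    and d: "d = fold max (map length adj) 0"
    and k: "\<forall>x\<in>set xs. k \<le> x" and neg: "hd ((list_step adj ^^ t) xs) < 0"
  shows "\<not> safe_level d k"
proof
  assume safe: "safe_level d k"
  have "(\<lambda>v. card (neighbours (list_graph adj) v)) ` pverts (list_graph adj)
      = (\<lambda>v. length (adj ! v)) ` {..<length adj}"
    using adjacency_listsD(1)[OF adj]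
    by (intro image_cong) (simp_all add: neighbours_list_graph pverts_list_graph distinct_card)
  also have "\<dots> = set (map length adj)"
    by (force simp: in_set_conv_nth)
  finally have "max_degree (list_graph adj) = Max (set (0 # map length adj))"
    by (simp add: max_degree_def)
  \<comment> \<open>The 0 inserted in \<open>max_degree\<close> is the starting value of the
    fold.\<close>
  also have "\<dots> = d"
    unfolding Max.set_eq_fold d ..
  finally have "diffusion (list_graph adj) ((!) xs) t 0 \<ge> 0"
    using safe pair_graph_list_graph[OF adj] len k
    unfolding safe_level_def by (simp add: pverts_list_graph)
  moreover have "(list_step adj ^^ t) xs \<noteq> []"
    using len by (cases t) (auto simp: list_step_def)
  ultimately show False
    using neg diffusion_list_graph[OF adj, of xs 0 t] len by (simp add: hd_conv_nth)
qed

section \<open>Counterexamples for degrees 0 to 3\<close>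

lemma not_safe_level_0: "\<not> safe_level 0 (-1)"
  by (rule not_safe_level_list_graph[of "[[]]" "[-1]" _ _ 0]) code_simp+

lemma not_safe_level_1: "\<not> safe_level 1 (-1)"
  by (rule not_safe_level_list_graph[of "[[1], [0]]" "[-1, -1]" _ _ 0]) code_simp+

text \<open>On a path with three vertices, the centre has one chip and gives one to each
  end.\<close>

lemma not_safe_level_2: "\<not> safe_level 2 0"
  by (rule not_safe_level_list_graph[of "[[1, 2], [0], [0]]" "[1, 0, 0]" _ _ 1]) code_simp+

text \<open>This labelled tree was found by a computer search.\<close>

lemma not_safe_level_3: "\<not> safe_level 3 2"
proof -
  define adj :: "nat list list" where "adj =
    [[1, 2, 3], [0, 4, 5], [0, 6, 7], [0, 8, 9], [1], [1], [2], [2],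
      [3, 10, 11], [3, 12, 13], [8], [8], [9], [9]]"
  define xs :: "int list" where "xs = [2, 2, 2, 3, 3, 2, 3, 2, 3, 3, 2, 2, 2, 2]"
  have "list_step adj xs = [3, 3, 3, 2, 2, 2, 2, 2, 1, 1, 3, 3, 3, 3]"
    by (simp add: list_step_def adj_def xs_def)
  moreover have "list_step adj [3, 3, 3, 2, 2, 2, 2, 2, 1, 1, 3, 3, 3, 3] =
      [2, 1, 1, 1, 3, 3, 3, 3, 4, 4, 2, 2, 2, 2]"
    by (simp add: list_step_def adj_def)
  \<comment> \<open>The root now has label 2 and three neighbours of label 1, so it drops to
    -1.\<close>
  moreover have "list_step adj [2, 1, 1, 1, 3, 3, 3, 3, 4, 4, 2, 2, 2, 2] =
      [-1, 4, 4, 4, 2, 2, 2, 2, 1, 1, 3, 3, 3, 3]"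
    by (simp add: list_step_def adj_def)
  ultimately have "hd ((list_step adj ^^ 3) xs) < 0"
    by (simp add: numeral_3_eq_3)
  then show ?thesis
  proof (rule not_safe_level_list_graph[rotated 5])
    show "adjacency_lists adj"
      unfolding adj_def by code_simp
  qed (simp_all add: adj_def xs_def)
qed

section \<open>Maximum degree at least 4\<close>

text \<open>
  Vertices are the paths from the root, written leaf to root, so that \<open>tl\<close> yields the parent. The
  root has \<open>d\<close> children, which makes the maximum degree exactly \<open>d\<close>.
\<close>

definition tree_verts :: "nat \<Rightarrow> nat \<Rightarrow> nat list set" where
  "tree_verts d n = {l. length l \<le> n \<and> set l \<subseteq> {..<d} \<and> set (butlast l) \<subseteq> {..<3}}"

definition tree_graph :: "nat \<Rightarrow> nat \<Rightarrow> nat list pair_pre_digraph" where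
  "tree_graph d n = \<lparr>pverts = tree_verts d n,
     parcs = {(l, m). l \<in> tree_verts d n \<and> m \<in> tree_verts d n \<and>
       (l \<noteq> [] \<and> m = tl l \<or> m \<noteq> [] \<and> l = tl m)}\<rparr>"

lemma finite_tree_verts: "finite (tree_verts d n)"
  by (rule finite_subset[OF _ finite_lists_length_le[of "{..<d}" n]]) (auto simp: tree_verts_def)

lemma tl_in_tree_verts: "l \<in> tree_verts d n \<Longrightarrow> tl l \<in> tree_verts d n"
  by (cases l; cases "tl l") (auto simp: tree_verts_def)

lemma pair_graph_tree_graph: "pair_graph (tree_graph d n)"
proof
  let ?G = "tree_graph d n"
  show arcs: "fst e \<in> pverts ?G" "snd e \<in> pverts ?G" if "e \<in> parcs ?G" for e
    using that by (auto simp: tree_graph_def)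
  show "finite (pverts ?G)"
    by (simp add: tree_graph_def finite_tree_verts)
  moreover have "parcs ?G \<subseteq> pverts ?G \<times> pverts ?G"
    using arcs by force
  ultimately show "finite (parcs ?G)"
    by (meson finite_SigmaI finite_subset)
  have "tl l \<noteq> l" if "l \<noteq> []" for l :: "nat list"
    using that by (cases l) auto
  then show "fst e \<noteq> snd e" if "e \<in> parcs ?G" for e
    using that by (fastforce simp: tree_graph_def)
  show "symmetric ?G"
    by (auto simp: tree_graph_def symmetric_def intro: symI)
qed

lemma neighbours_root:
  assumes "n > 0"
  shows "neighbours (tree_graph d n) [] = (\<lambda>c. [c]) ` {..<d}"
proof (rule set_eqI)
  show "m \<in> neighbours (tree_graph d n) [] \<longleftrightarrow> m \<in> (\<lambda>c. [c]) ` {..<d}" for m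
    using assms by (cases m) (auto simp: neighbours_def tree_graph_def tree_verts_def)
qed

lemma neighbours_tree_graph:
  assumes "l \<in> tree_verts d n" "l \<noteq> []" "d \<ge> 3"
  shows "neighbours (tree_graph d n) l =
    insert (tl l) (if length l < n then (\<lambda>c. c # l) ` {..<3} else {})"
proof (rule set_eqI)
  fix m
  \<comment> \<open>As \<open>l\<close> is not the root, \<open>c\<close> falls under the bound 3,
    which implies the bound \<open>d\<close>.\<close>
  have "c # l \<in> tree_verts d n \<longleftrightarrow> length l < n \<and> c < 3" for c
    using assms by (auto simp: tree_verts_def)
  then have "m \<in> tree_verts d n \<and> m \<noteq> [] \<and> l = tl m \<longleftrightarrow>
      length l < n \<and> m \<in> (\<lambda>c. c # l) ` {..<3}"
    by (cases m) auto
  moreover have "m \<in> neighbours (tree_graph d n) l \<longleftrightarrow>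
      m = tl l \<or> m \<in> tree_verts d n \<and> m \<noteq> [] \<and> l = tl m"
    unfolding neighbours_def tree_graph_def using assms tl_in_tree_verts[OF assms(1)] by auto
  ultimately show "m \<in> neighbours (tree_graph d n) l \<longleftrightarrow>
      m \<in> insert (tl l) (if length l < n then (\<lambda>c. c # l) ` {..<3} else {})"
    by simp
qed

text \<open>Other vertices have at most a parent and three children, so the root attains the maximum
  once \<open>d \<ge> 4\<close>.\<close>

lemma max_degree_tree_graph:
  assumes "d \<ge> 4" "n > 0"
  shows "max_degree (tree_graph d n) = d"
proof (rule max_degree_eqI)
  have root: "card (neighbours (tree_graph d n) []) = d"
    using assms by (simp add: neighbours_root card_image inj_on_def)
  then show "card (neighbours (tree_graph d n) []) = d" .
  show "card (neighbours (tree_graph d n) l) \<le> d" if "l \<in> pverts (tree_graph d n)" for l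
  proof (cases "l = []")
    case False
    have "card ((\<lambda>c. c # l) ` {..<3::nat}) \<le> 3"
      using card_image_le[of "{..<3::nat}"] by force
    then have "card (insert (tl l) ((\<lambda>c. c # l) ` {..<3::nat})) \<le> 4"
      by (simp add: card_insert_if)
    moreover have "l \<in> tree_verts d n"
      using that by (simp add: tree_graph_def)
    ultimately show ?thesis
      using False assms by (simp add: neighbours_tree_graph)
  qed (simp add: root)
  show "[] \<in> pverts (tree_graph d n)"
    by (simp add: tree_graph_def tree_verts_def)
qed (simp add: tree_graph_def finite_tree_verts)

text \<open>
  The leaf level does not matter until time \<open>n - length l\<close>, hence the first bound on \<open>t\<close>, and the
  root does not matter until time \<open>length l\<close>, hence the second.
\<close>

lemma diffusion_tree_graph:
  assumes d: "d \<ge> 4" and w: "w = (\<lambda>l. k + int n - int (length l))"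
    and "l \<in> tree_verts d n" "t + length l \<le> n" "t \<le> length l"
  shows "diffusion (tree_graph d n) w t l = w l - 2 * int t"
  using assms(3-)
proof (induction t arbitrary: l)
  case (Suc t)
  let ?w = "diffusion (tree_graph d n) w t"
  have l: "l \<noteq> []" "length l < n" "d \<ge> 3" using Suc.prems d by auto
  note nb = neighbours_tree_graph[OF Suc.prems(1) l(1,3)]
  \<comment> \<open>Parent, vertex and children have all lost \<open>2 * int t\<close> so far, so
    the initial differences of 1 persist. Both bounds on \<open>Suc t\<close> leave the one unit of
    slack needed for parent and children.\<close>
  have child: "?w (c # l) = ?w l - 1" if "c < 3" for c
  proof -
    have "c # l \<in> tree_verts d n"
      using Suc.prems l that by (auto simp: tree_verts_def)
    then show ?thesis
      using Suc by (simp add: w)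
  qed
  have "?w (tl l) = w (tl l) - 2 * int t"
    using Suc.prems tl_in_tree_verts by (intro Suc.IH) auto
  moreover have here: "?w l = w l - 2 * int t"
    using Suc by simp
  moreover have "w (tl l) = w l + 1"
    using l by (cases l) (auto simp: w)
  ultimately have parent: "?w (tl l) = ?w l + 1" by simp
  have "tl l \<notin> (\<lambda>c. c # l) ` {..<3}"
    by (auto dest: arg_cong[of _ _ length])
  then have "(\<Sum>u\<in>neighbours (tree_graph d n) l. sgn (?w u - ?w l))
      = 1 + (\<Sum>u\<in>(\<lambda>c. c # l) ` {..<3}. sgn (?w u - ?w l))"
    using l by (simp add: nb parent)
  also have "\<dots> = 1 + (\<Sum>c<3. sgn (?w (c # l) - ?w l))"
    by (subst sum.reindex) (auto simp: inj_on_def)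
  also have "\<dots> = -2"
    using child by simp
  finally show ?case
    using here by (simp add: diffusion_step_sum nb)
qed simp

lemma not_safe_level_ge_4:
  assumes "d \<ge> 4"
  shows "\<not> safe_level d k"
proof
  assume safe: "safe_level d k"
  \<comment> \<open>In a tree of height \<open>2 * m\<close> the leaves start at \<open>k\<close>.
    Depth \<open>m\<close> is the middle, where both bounds allow time \<open>m\<close>; the label
    there falls from \<open>k + int m\<close> to \<open>k - int m\<close>, negative because
    \<open>m\<close> exceeds \<open>k\<close>.\<close>
  define m where "m = nat k + 1"
  define w where "w = (\<lambda>l :: nat list. k + int (2 * m) - int (length l))"
  let ?G = "tree_graph d (2 * m)" and ?l = "replicate m (0 :: nat)"
  have deg: "max_degree ?G = d"
    using assms by (intro max_degree_tree_graph) (auto simp: m_def)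
  have l: "?l \<in> tree_verts d (2 * m)"
    using assms by (auto simp: tree_verts_def dest!: in_set_butlastD)
  have "diffusion ?G w m ?l \<ge> 0"
  \<comment> \<open>The tree has lists as vertices, whereas \<open>safe_level\<close> speaks of
    graphs on \<open>nat\<close>.\<close>
  proof (rule safe_level_any_type)
    show "safe_level (max_degree ?G) k"
      using safe deg by simp
    show "k \<le> w v" if "v \<in> pverts ?G" for v
      using that by (auto simp: w_def tree_graph_def tree_verts_def)
      show "?l \<in> pverts ?G"
      using l by (simp add: tree_graph_def)
  qed (rule pair_graph_tree_graph)
  moreover have "diffusion ?G w m ?l = w ?l - 2 * int m"
    using assms l by (intro diffusion_tree_graph[OF _ w_def]) auto
  moreover have "w ?l = k + int m" "k < int m"
    by (auto simp: w_def m_def)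
  ultimately show False
    by simp
qed

theorem theorem2:
  fixes d :: nat
  shows "(d \<le> 1 \<longrightarrow> g d = Fin 0) \<and>
         (d = 2 \<longrightarrow> g d = Fin 1) \<and>
         (d = 3 \<longrightarrow> g d \<ge> Fin 3) \<and>
         (d \<ge> 4 \<longrightarrow> g d = Pinf)"
proof (intro conjI impI)
  assume "d \<le> 1"
  moreover from this have "\<not> safe_level d (-1)"
    using not_safe_level_0 not_safe_level_1 by (cases "d = 0") (auto simp: le_Suc_eq)
  ultimately show "g d = Fin 0"
    using safe_level_0 by (intro g_eqI) auto
next
  assume "d = 2"
  then show "g d = Fin 1"
    using safe_level_2 not_safe_level_2 by (intro g_eqI) auto
next
  assume "d = 3"
  then show "g d \<ge> Fin 3"
    using not_safe_level_3 by (intro g_geI) auto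
next
  assume "d \<ge> 4"
  then show "g d = Pinf"
    using not_safe_level_ge_4 by (simp add: g_def)
qed

end
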